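(* Suppose $(X,\mathcal{A},\mu,T)$ is an ergodic probability preserving system, $(A_l)$ an asymptotically rare sequence in $\mathcal{A}$, and $(\psi_{A_l})_{l\ge1}$ a sequence of $\mathfrak{F}$-valued local observables for the $A_l$ with corresponding local processes $\Psi_{A_l}$. Assume there are measurable $\tau_l:X\to\mathbb{N}_0$ with $\mu_{A_l}(\tau_l<\varphi_{A_l})\to1$ as $l\to\infty$, while there is a compact subset $\mathfrak{K}$ of $(\mathfrak{P},d_{\mathfrak{P}})$ with $T^{\tau_l}_\ast\mu_{A_l}\in\mathfrak{K}$ for $l\ge1$. Let $(\Phi_{\mathrm{Exp}},\Psi^\ast)$ be an independent pair of iid sequences ($\Phi_{\mathrm{Exp}}$ iid standard exponential, $\Psi^\ast$ iid in $\mathfrak{F}$). Then $$(\mu(A_l)\Phi_{A_l},\Psi_{A_l})\overset{\mu}{\Longrightarrow}(\Phi_{\mathrm{Exp}},\Psi^\ast)\quad\text{iff}\quad(\mu(A_l)\Phi_{A_l},\widetilde\Psi_{A_l})\overset{\mu_{A_l}}{\Longrightarrow}(\Phi_{\mathrm{Exp}},\Psi^\ast)\qquad\text{as }l\to\infty.$$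
   Context: $(\mathfrak{F},d_{\mathfrak{F}})$ compact metric space. For $A$ with $\mu(A)>0$: $\varphi_A(x):=\inf\{n\ge1:T^nx\in A\}$, $T_Ax:=T^{\varphi_A(x)}x$, $\mu_A:=\mu(A\cap\cdot)/\mu(A)$, $\Phi_A:=(\varphi_A,\varphi_A\circ T_A,\ldots)$ viewed in $[0,\infty]^{\mathbb{N}_0}$ ($[0,\infty]$ metrized by $|e^{-s}-e^{-t}|$, product metric). Asymptotically rare: $0<\mu(A_l)\to0$. Local observable: measurable $\psi_A:A\to\mathfrak{F}$; $\Psi_A:=(\psi_A\circ T_A,\psi_A\circ T_A^2,\ldots):X\to\mathfrak{F}^{\mathbb{N}}$, $\widetilde\Psi_A:=(\psi_A,\psi_A\circ T_A,\ldots):A\to\mathfrak{F}^{\mathbb{N}_0}$. $\mathfrak{P}$: probabilities $\nu\ll\mu$, $d_{\mathfrak{P}}(\nu,\nu')=2\sup_A|\nu(A)-\nu'(A)|$. $T^\tau x:=T^{\tau(x)}x$, $T^\tau_\ast\nu:=\nu\circ(T^\tau)^{-1}$. $\overset{\nu}{\Longrightarrow}$: weak convergence of laws under $\nu$. *)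

theory Defs
  imports "HOL-Probability.Probability"
begin

definition ergodic_pps :: "'a measure \<Rightarrow> ('a \<Rightarrow> 'a) \<Rightarrow> bool" where
  "ergodic_pps M T \<longleftrightarrow> prob_space M \<and> T \<in> measurable M M \<and> distr M M T = M \<and>
     (\<forall>B\<in>sets M. T -` B \<inter> space M = B \<longrightarrow> measure M B = 0 \<or> measure M B = 1)"

definition hit_time :: "('a \<Rightarrow> 'a) \<Rightarrow> 'a set \<Rightarrow> 'a \<Rightarrow> enat" where
  "hit_time T A x = (if \<exists>n\<ge>1. (T ^^ n) x \<in> A
     then enat (LEAST n. n \<ge> 1 \<and> (T ^^ n) x \<in> A) else \<infinity>)"

text \<open>Induced (first return) map T_A x = T^{phi_A(x)} x; convention: T_A x = x if phi_A(x) = infinity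
  (this only happens on a null set in the situation considered).\<close>
definition induced_map :: "('a \<Rightarrow> 'a) \<Rightarrow> 'a set \<Rightarrow> 'a \<Rightarrow> 'a" where
  "induced_map T A x = (case hit_time T A x of enat n \<Rightarrow> (T ^^ n) x | \<infinity> \<Rightarrow> x)"

definition return_process :: "('a \<Rightarrow> 'a) \<Rightarrow> 'a set \<Rightarrow> 'a \<Rightarrow> nat \<Rightarrow> ennreal" where
  "return_process T A x n = ennreal_of_enat (hit_time T A ((induced_map T A ^^ n) x))"

text \<open>Local observable psi_A : A -> F, only its values on A are used (a fixed default value off A).\<close>
definition loc_obs :: "('a \<Rightarrow> 'f) \<Rightarrow> 'a set \<Rightarrow> 'a \<Rightarrow> 'f" where
  "loc_obs \<psi> A y = (if y \<in> A then \<psi> y else undefined)"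

definition local_process :: "('a \<Rightarrow> 'a) \<Rightarrow> 'a set \<Rightarrow> ('a \<Rightarrow> 'f) \<Rightarrow> 'a \<Rightarrow> nat \<Rightarrow> 'f" where
  "local_process T A \<psi> x n = loc_obs \<psi> A ((induced_map T A ^^ Suc n) x)"

definition local_process0 :: "('a \<Rightarrow> 'a) \<Rightarrow> 'a set \<Rightarrow> ('a \<Rightarrow> 'f) \<Rightarrow> 'a \<Rightarrow> nat \<Rightarrow> 'f" where
  "local_process0 T A \<psi> x n = loc_obs \<psi> A ((induced_map T A ^^ n) x)"

definition weak_conv_law ::
  "(nat \<Rightarrow> 'a measure) \<Rightarrow> (nat \<Rightarrow> 'a \<Rightarrow> 'b::topological_space) \<Rightarrow> 'b measure \<Rightarrow> bool" where
  "weak_conv_law \<nu> Y L \<longleftrightarrow>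
     (\<forall>f :: 'b \<Rightarrow> real. continuous_on UNIV f \<and> bounded (range f) \<longrightarrow>
        ((\<lambda>l. \<integral>x. f (Y l x) \<partial>(\<nu> l)) \<longlonglongrightarrow> (\<integral>y. f y \<partial>L)))"

definition abs_cont_probs :: "'a measure \<Rightarrow> 'a measure set" where
  "abs_cont_probs M = {\<nu>. sets \<nu> = sets M \<and> prob_space \<nu> \<and> absolutely_continuous M \<nu>}"

definition dP :: "'a measure \<Rightarrow> 'a measure \<Rightarrow> 'a measure \<Rightarrow> real" where
  "dP M \<nu> \<nu>' = 2 * (SUP B\<in>sets M. \<bar>measure \<nu> B - measure \<nu>' B\<bar>)"

definition exp_iid_law :: "(nat \<Rightarrow> ennreal) measure" where
  "exp_iid_law = (\<Pi>\<^sub>M n\<in>UNIV. distr (density lborel (exponential_density 1)) borel ennreal)"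

definition limit_law :: "'f measure \<Rightarrow> ((nat \<Rightarrow> ennreal) \<times> (nat \<Rightarrow> 'f)) measure" where
  "limit_law Q = exp_iid_law \<Otimes>\<^sub>M (\<Pi>\<^sub>M n\<in>UNIV. Q)"

end

theory Submission
  imports Defs
begin

text \<open>
  Write c for the measure of A, phi for the first hitting time, R(y) for the pair of rescaled
  return times and observables seen from y in A, and H(x) for the pair seen from an arbitrary x;
  H(x) consists of c phi(x) and R(T_A x). For s > 0 and bounded h let
  G(x) = exp(-s c phi(x)) h(R(T_A x)). Comparing G(x) with G(T x) and using invariance gives
  the exact Palm-type identity
  (exp(s c) - 1) / c * E_mu[G] = E_{mu_A}[h(R)] - E_{mu_A}[G].
  As c tends to 0 the factor tends to s, while for the iid exponential limit the Laplace factor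
  splits off as 1 / (1 + s). If the hitting pair converges and h \<ge> 0, letting s tend to infinity
  bounds the liminf of E_{mu_A}[h(R)] from below by the limit value; applied to B + h and B - h
  this is convergence of the return pair. If the return pair converges, the identity yields the
  limits of E_mu[G] for all s > 0, and s to 0 and Stone-Weierstrass give convergence of the
  hitting pair.
\<close>

section \<open>Exponential weights on [0, \<infinity>]\<close>

definition lap :: "real \<Rightarrow> ennreal \<Rightarrow> real" where
  "lap s x = (if x = \<top> then 0 else exp (- s * enn2real x))"

text \<open>The value at infinity is 0 even for s = 0, so multiplicativity holds but continuity needs s > 0.\<close>

lemma lap_nonneg [simp]: "0 \<le> lap s x"
  by (simp add: lap_def)

lemma lap_le_1: "0 \<le> s \<Longrightarrow> lap s x \<le> 1"
  by (simp add: lap_def)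

lemma abs_lap_le_1: "0 \<le> s \<Longrightarrow> \<bar>lap s x\<bar> \<le> 1"
  by (simp add: lap_le_1)

lemma lap_add: "lap s (x + y) = lap s x * lap s y"
  by (cases x; cases y) (auto simp: lap_def distrib_left simp flip: ennreal_plus exp_add)

lemma lap_ennreal: "0 \<le> r \<Longrightarrow> lap s (ennreal r) = exp (- s * r)"
  by (simp add: lap_def)

lemma inj_lap: "s > 0 \<Longrightarrow> inj (lap s)"
  by (rule injI, rename_tac x y, case_tac x; case_tac y) (auto simp: lap_def)

text \<open>Fails for \<open>k = 0\<close> at infinity, where the power is 1 but
  \<open>lap 0\<close> is 0. The exponent 0 therefore gets separate treatment later.\<close>

lemma lap_power: "0 < k \<Longrightarrow> lap 1 x ^ k = lap (real k) x"
  by (auto simp: lap_def exp_of_nat_mult[symmetric])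

lemma continuous_on_lap:
  assumes "s > 0"
  shows "continuous_on UNIV (lap s)"
proof -
  have "(lap s \<longlongrightarrow> lap s x) (at x)" for x
  proof (cases x)
    case (real r)
    have fin: "eventually (\<lambda>y. y < \<top>) (at x)"
      using real by (intro order_tendstoD(2)[OF tendsto_ident_at]) simp
    have "((\<lambda>y. exp (- s * enn2real y)) \<longlongrightarrow> exp (- s * r)) (at x)"
      using real by (intro tendsto_intros tendsto_enn2real) auto
    then show ?thesis
      using real by (subst tendsto_cong[OF eventually_mono[OF fin]]) (auto simp: lap_def)
  next
    case top
    show ?thesis
    proof (rule tendstoI)
      fix e :: real assume e: "e > 0"
      \<comment> \<open>Beyond \<open>- ln e / s\<close> the weight is below \<open>e\<close>; the
        maximum with 0 makes \<open>r\<close> a legitimate argument of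
        \<open>ennreal\<close>.\<close>
      define r where "r = max 0 (- ln e / s)"
      have "eventually (\<lambda>y. ennreal r < y) (at x)"
        using top by (intro order_tendstoD(1)[OF tendsto_ident_at]) simp
      then show "eventually (\<lambda>y. dist (lap s y) (lap s x) < e) (at x)"
      proof (rule eventually_mono)
        fix y assume y: "ennreal r < y"
        show "dist (lap s y) (lap s x) < e"
        proof (cases y)
          case (real t)
          have "0 \<le> r" by (simp add: r_def)
          then have "r < t" using y real by (simp add: ennreal_less_iff)
          then have "- ln e / s < t" by (simp add: r_def)
          then have "- s * t < ln e"
            using assms by (simp add: field_simps)
          then have "exp (- s * t) < e"
            using e by (metis exp_less_mono exp_ln)
          then show ?thesis using real top by (simp add: lap_def)
        qed (use top e in auto)
      qed
    qed
  qed
  then show ?thesis by (simp add: continuous_on_def)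
qed

lemma measurable_lap [measurable]: "s > 0 \<Longrightarrow> lap s \<in> borel_measurable borel"
  by (intro borel_measurable_continuous_onI continuous_on_lap)

section \<open>One step of \<open>T\<close> for hitting times and the induced map\<close>

text \<open>First-step decomposition. A point that never hits \<open>A\<close> is covered as well,
  because \<open>eSuc\<close> fixes \<infinity>.\<close>

lemma hit_time_step:
  "hit_time T A x = (if T x \<in> A then 1 else eSuc (hit_time T A (T x)))"
proof (cases "T x \<in> A")
  case True
  then have "(LEAST n. n \<ge> 1 \<and> (T ^^ n) x \<in> A) = 1"
    by (intro Least_equality) auto
  then show ?thesis
    using True by (auto simp: hit_time_def one_enat_def intro!: exI[of _ 1])
next
  case False
  let ?P = "\<lambda>n. n \<ge> 1 \<and> (T ^^ n) x \<in> A" and ?Q = "\<lambda>n. n \<ge> 1 \<and> (T ^^ n) (T x) \<in> A"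
  \<comment> \<open>For \<open>n = 0\<close> both sides are false: \<open>?P 1\<close> would put
    \<open>T x\<close> into \<open>A\<close>, and \<open>?Q 0\<close> violates the lower bound on
    the index.\<close>
  have PQ: "?P (Suc n) \<longleftrightarrow> ?Q n" for n
    using False by (cases n) (auto simp: funpow_swap1)
  show ?thesis
  proof (cases "\<exists>n. ?Q n")
    case True
    then obtain n where "?Q n" by blast
    then have "?P (Suc n)" using PQ by blast
    then have "(LEAST n. ?P n) = Suc (LEAST n. ?P (Suc n))"
      by (rule Least_Suc) simp
    then show ?thesis
      using True exI[of ?P, OF \<open>?P (Suc n)\<close>] False unfolding hit_time_def PQ by (simp add: eSuc_enat)
  next
    case none: False
    have "\<not> ?P n" for n
      using none PQ by (cases n) auto
    then show ?thesis
      using none False by (auto simp: hit_time_def)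
  qed
qed

text \<open>Off \<open>A\<close> the first visit of \<open>x\<close> is that of \<open>T x\<close>,
  except when there is none: then the convention returns the starting point, and the starting points
  \<open>x\<close> and \<open>T x\<close> may differ.\<close>

lemma induced_map_step:
  "induced_map T A x =
     (if T x \<in> A then T x else if hit_time T A (T x) = \<infinity> then x else induced_map T A (T x))"
proof (cases "T x \<in> A")
  case True
  then show ?thesis
    using hit_time_step[of T A x] by (simp add: induced_map_def one_enat_def)
next
  case False
  then show ?thesis
    using hit_time_step[of T A x]
    by (cases "hit_time T A (T x)") (auto simp: induced_map_def eSuc_enat funpow_swap1)
qed

lemma measurable_hit_time [measurable]:
  assumes [measurable]: "T \<in> measurable M M" "A \<in> sets M"
  shows "hit_time T A \<in> measurable M (count_space UNIV)"
proof -
  have [measurable]: "(T ^^ n) \<in> measurable M M" for n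
    by (rule measurable_compose_n) measurable
  show ?thesis unfolding hit_time_def by measurable
qed

lemma measurable_induced_map [measurable]:
  assumes [measurable]: "T \<in> measurable M M" "A \<in> sets M"
  shows "induced_map T A \<in> measurable M M"
proof -
  have [measurable]: "(T ^^ n) \<in> measurable M M" for n
    by (rule measurable_compose_n) measurable
  \<comment> \<open>The hitting time takes countably many values, so choosing the iterate according
    to its value preserves measurability.\<close>
  have "(\<lambda>x. (\<lambda>e x. case e of enat n \<Rightarrow> (T ^^ n) x | \<infinity> \<Rightarrow> x) (hit_time T A x) x) \<in> measurable M M"
    by (rule measurable_compose_countable[OF _ measurable_hit_time])
       (auto split: enat.split)
  then show ?thesis unfolding induced_map_def .
qed

section \<open>The Palm-type identity\<close>

text \<open>Moving the starting point one step forward multiplies the weight by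
  \<open>exp (s * c)\<close>, except that a point arriving in \<open>A\<close> starts counting
  afresh there. Integrating this pointwise relation and using invariance of \<open>M\<close> gives
  the identity without discarding any null set.\<close>

lemma integral_lap_hit_time:
  fixes h :: "'a \<Rightarrow> real"
  assumes M: "prob_space M" and T [measurable]: "T \<in> measurable M M" and inv: "distr M M T = M"
    and A [measurable]: "A \<in> sets M" and s: "s > 0" and c: "c > 0"
    and h [measurable]: "h \<in> borel_measurable M" and bd: "\<And>x. x \<in> space M \<Longrightarrow> \<bar>h x\<bar> \<le> B"
  defines "G \<equiv> \<lambda>x. lap s (ennreal c * ennreal_of_enat (hit_time T A x)) * h (induced_map T A x)"
  shows "(exp (s * c) - 1) * (\<integral>x. G x \<partial>M) = (\<integral>x. indicator A x * h x \<partial>M) - (\<integral>x. indicator A x * G x \<partial>M)"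
proof -
  interpret prob_space M by fact
  have [measurable]: "G \<in> borel_measurable M"
    unfolding G_def using s by measurable
  have B: "0 \<le> B" using bd not_empty by fastforce
  have Gb: "\<bar>G x\<bar> \<le> B" if "x \<in> space M" for x
  proof -
    have "induced_map T A x \<in> space M"
      using measurable_space[OF measurable_induced_map[OF T A] that] .
    then have "\<bar>G x\<bar> \<le> 1 * B"
      unfolding G_def abs_mult using s bd by (intro mult_mono abs_lap_le_1) auto
    then show ?thesis by simp
  qed
  have iG: "integrable M G"
    by (rule integrable_const_bound[where B=B]) (use Gb in auto)
  have ih: "integrable M h"
    by (rule integrable_const_bound[where B=B]) (use bd in auto)
  have iAG: "integrable M (\<lambda>x. indicator A x * G x)"
    using integrable_mult_indicator[OF A iG] by simp
  have iAh: "integrable M (\<lambda>x. indicator A x * h x)"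
    using integrable_mult_indicator[OF A ih] by simp
  \<comment> \<open>\<open>F\<close> equals \<open>h\<close> on \<open>A\<close> and
    \<open>G\<close> off \<open>A\<close>: it is what remains of \<open>G x\<close> at
    \<open>T x\<close> once the cost \<open>exp (- s * c)\<close> of one step is paid.\<close>
  define F where "F x = indicator A x * h x + (G x - indicator A x * G x)" for x
  have [measurable]: "F \<in> borel_measurable M" unfolding F_def by measurable
  have GF: "G x = exp (- s * c) * F (T x)" for x
  proof (cases "T x \<in> A")
    case True
    then have "hit_time T A x = 1" "induced_map T A x = T x"
      by (simp_all add: hit_time_step[of T A x] induced_map_step[of T A x])
    then show ?thesis using True c
      by (simp add: G_def F_def one_enat_def lap_ennreal)
  next
    case False
    show ?thesis
    proof (cases "hit_time T A (T x)")
      case (enat n)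
      have "hit_time T A x = eSuc (hit_time T A (T x))" "induced_map T A x = induced_map T A (T x)"
        using False enat by (simp_all add: hit_time_step[of T A x] induced_map_step[of T A x])
      then show ?thesis using False c
        by (simp add: G_def F_def ennreal_of_enat_eSuc ring_distribs lap_add lap_ennreal)
    next
      \<comment> \<open>Without a visit to \<open>A\<close> both weights are 0, so the relation
        holds although \<open>induced_map\<close> gives different points for \<open>x\<close> and
        \<open>T x\<close> in general.\<close>
      case infinity
      then have "hit_time T A x = \<infinity>" using False by (simp add: hit_time_step[of T A x])
      then show ?thesis
        using False infinity c by (simp add: G_def F_def lap_def ennreal_mult_top)
    qed
  qed
  have "(\<integral>x. G x \<partial>M) = exp (- s * c) * (\<integral>x. F (T x) \<partial>M)"
    by (subst GF) simp
  also have "(\<integral>x. F (T x) \<partial>M) = (\<integral>x. F x \<partial>M)"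
    using integral_distr[OF T, of F] inv by simp
  also have "\<dots> = (\<integral>x. indicator A x * h x \<partial>M) + ((\<integral>x. G x \<partial>M) - (\<integral>x. indicator A x * G x \<partial>M))"
    unfolding F_def by (simp add: iG iAG iAh)
  finally have "exp (s * c) * (\<integral>x. G x \<partial>M) = (\<integral>x. indicator A x * h x \<partial>M) + ((\<integral>x. G x \<partial>M) - (\<integral>x. indicator A x * G x \<partial>M))"
    by (simp add: exp_minus field_simps)
  then show ?thesis by (simp add: algebra_simps)
qed

lemma integral_uniform_measure:
  fixes f :: "'a \<Rightarrow> real"
  assumes "prob_space M" and [measurable]: "A \<in> sets M" "f \<in> borel_measurable M" and pos: "measure M A > 0"
  shows "(\<integral>x. f x \<partial>uniform_measure M A) = (\<integral>x. indicator A x * f x \<partial>M) / measure M A"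
proof -
  interpret prob_space M by fact
  have "uniform_measure M A = density M (\<lambda>x. ennreal (indicator A x / measure M A))"
    unfolding uniform_measure_def using pos
    by (intro density_cong AE_I2) (auto simp: emeasure_eq_measure divide_ennreal ennreal_indicator[symmetric] simp del: ennreal_indicator)
  then show ?thesis
    by (simp add: integral_density)
qed

section \<open>The limit law: Laplace factor and independence\<close>

text \<open>Prepending an independent coordinate with law \<open>N\<close> to an iid sequence
  reproduces the iid law (\<open>PiM_iter\<close>); Fubini then separates the two factors.
  Boundedness gives the integrability that Fubini asks for.\<close>

lemma sequence_space_integral_split:
  fixes g :: "'b \<Rightarrow> real" and h :: "(nat \<Rightarrow> 'b) \<Rightarrow> real"
  assumes N: "prob_space N" and [measurable]: "g \<in> borel_measurable N" "h \<in> borel_measurable (\<Pi>\<^sub>M n\<in>UNIV. N)"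
    and g: "\<And>x. \<bar>g x\<bar> \<le> C" and h: "\<And>w. \<bar>h w\<bar> \<le> D"
  shows "(\<integral>w. g (w 0) * h (\<lambda>n. w (Suc n)) \<partial>(\<Pi>\<^sub>M n\<in>(UNIV::nat set). N)) =
         (\<integral>x. g x \<partial>N) * (\<integral>w. h w \<partial>(\<Pi>\<^sub>M n\<in>UNIV. N))"
proof -
  interpret N: prob_space N by fact
  interpret sequence_space N
    by unfold_locales
  interpret NP: pair_prob_space N "\<Pi>\<^sub>M n\<in>(UNIV::nat set). N"
    by unfold_locales
  let ?P = "\<Pi>\<^sub>M n\<in>(UNIV::nat set). N"
  have [measurable]: "(\<lambda>w n. w (Suc n)) \<in> measurable ?P ?P"
    by (intro measurable_PiM_single') (auto simp: space_PiM)
  have "(\<integral>w. g (w 0) * h (\<lambda>n. w (Suc n)) \<partial>?P) =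
    (\<integral>w. g (w 0) * h (\<lambda>n. w (Suc n)) \<partial>distr (N \<Otimes>\<^sub>M ?P) ?P (\<lambda>(s, \<omega>). case_nat s \<omega>))"
    by (simp add: PiM_iter)
  also have "\<dots> = (\<integral>(x, w). g x * h w \<partial>(N \<Otimes>\<^sub>M ?P))"
    by (subst integral_distr) (measurable, simp add: case_prod_unfold)
  also have "\<dots> = (\<integral>x. \<integral>w. g x * h w \<partial>?P \<partial>N)"
  proof (rule NP.integral_fst[symmetric])
    have "0 \<le> C" using g[of undefined] by linarith
    then have "\<bar>g x * h w\<bar> \<le> C * D" for x w
      unfolding abs_mult using g h by (intro mult_mono) auto
    then show "integrable (N \<Otimes>\<^sub>M ?P) (\<lambda>(x, w). g x * h w)"
      by (intro NP.integrable_const_bound[where B="C * D"]) auto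
  qed
  also have "\<dots> = (\<integral>x. g x \<partial>N) * (\<integral>w. h w \<partial>?P)"
    by simp
  finally show ?thesis .
qed

abbreviation exp_law :: "ennreal measure" where
  "exp_law \<equiv> distr (density lborel (exponential_density 1)) borel ennreal"

lemma prob_space_exp_law: "prob_space exp_law"
  by (intro prob_space.prob_space_distr prob_space_exponential_density) auto

text \<open>The weight turns the standard exponential density into \<open>1 / (1 + s)\<close> times
  the exponential density of rate \<open>1 + s\<close>, whose total mass is 1.\<close>

lemma integral_lap_exp_law:
  assumes "s > 0"
  shows "(\<integral>x. lap s x \<partial>exp_law) = 1 / (1 + s)"
proof -
  interpret E: prob_space "density lborel (exponential_density (1 + s))"
    using assms by (intro prob_space_exponential_density) auto
  have "(\<integral>x. lap s x \<partial>exp_law) = (\<integral>x. exponential_density 1 x * lap s (ennreal x) \<partial>lborel)"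
    using assms by (subst integral_distr) (auto simp: integral_density exponential_density_nonneg)
  also have "\<dots> = (\<integral>x. exponential_density (1 + s) x / (1 + s) \<partial>lborel)"
  proof (intro Bochner_Integration.integral_cong refl)
    fix x :: real
    have "exp (- x) * exp (- (s * x)) = exp (- (x * (1 + s)))"
      by (simp add: algebra_simps flip: exp_add)
    then show "exponential_density 1 x * lap s (ennreal x) = exponential_density (1 + s) x / (1 + s)"
      using assms by (simp add: exponential_density_def lap_ennreal)
  qed
  also have "\<dots> = (\<integral>x. exponential_density (1 + s) x * 1 \<partial>lborel) / (1 + s)"
    by simp
  also have "(\<integral>x. exponential_density (1 + s) x * 1 \<partial>lborel) = (\<integral>x. 1 \<partial>density lborel (exponential_density (1 + s)))"
    using assms by (subst integral_density) (auto simp: exponential_density_nonneg)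
  also have "\<dots> = 1" using E.prob_space by simp
  finally show ?thesis .
qed

lemma prob_space_exp_iid_law: "prob_space exp_iid_law"
  unfolding exp_iid_law_def by (intro prob_space_PiM prob_space_exp_law)

lemma sets_exp_iid_law: "sets exp_iid_law = sets borel"
proof -
  have "sets exp_iid_law = sets (\<Pi>\<^sub>M n\<in>UNIV. (borel :: ennreal measure))"
    unfolding exp_iid_law_def by (intro sets_PiM_cong) auto
  then show ?thesis by (simp add: sets_PiM_equal_borel)
qed

lemma prob_space_limit_law:
  assumes "prob_space Q"
  shows "prob_space (limit_law Q)"
proof -
  interpret P: prob_space "\<Pi>\<^sub>M n\<in>(UNIV::nat set). Q"
    using assms by (intro prob_space_PiM)
  interpret E: prob_space exp_iid_law by (rule prob_space_exp_iid_law)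
  interpret EP: pair_prob_space exp_iid_law "\<Pi>\<^sub>M n\<in>(UNIV::nat set). Q" ..
  show ?thesis unfolding limit_law_def by unfold_locales
qed

text \<open>In second countable spaces the product sigma-algebra is the Borel one. This makes
  continuous functions measurable for the limit law.\<close>

lemma sets_limit_law:
  fixes Q :: "'f::polish_space measure"
  assumes "sets Q = sets borel"
  shows "sets (limit_law Q) = sets borel"
proof -
  have "sets (\<Pi>\<^sub>M n\<in>(UNIV::nat set). Q) = sets (\<Pi>\<^sub>M n\<in>(UNIV::nat set). (borel :: 'f measure))"
    using assms by (intro sets_PiM_cong) auto
  also have "\<dots> = sets borel" by (rule sets_PiM_equal_borel)
  finally have "sets (limit_law Q) = sets (borel \<Otimes>\<^sub>M borel)"
    unfolding limit_law_def by (intro sets_pair_measure_cong sets_exp_iid_law)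
  then show ?thesis unfolding borel_prod .
qed

text \<open>The two shifts differ because hitting observables already start at the first visit to
  \<open>A\<close>, whereas return observables start at the point itself. Each shift turns its pair
  into the return pair seen from \<open>induced_map T A x\<close>.\<close>

definition drop_time :: "(nat \<Rightarrow> 'b) \<times> (nat \<Rightarrow> 'c) \<Rightarrow> (nat \<Rightarrow> 'b) \<times> (nat \<Rightarrow> 'c)" where
  "drop_time p = (\<lambda>n. fst p (Suc n), snd p)"

definition drop_both :: "(nat \<Rightarrow> 'b) \<times> (nat \<Rightarrow> 'c) \<Rightarrow> (nat \<Rightarrow> 'b) \<times> (nat \<Rightarrow> 'c)" where
  "drop_both p = (\<lambda>n. fst p (Suc n), \<lambda>n. snd p (Suc n))"

lemma continuous_on_coordinate:
  assumes "continuous_on UNIV f"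
  shows "continuous_on UNIV (\<lambda>p. f p n)"
  using continuous_on_compose2[OF continuous_on_product_coordinates[of n] assms] by simp

lemma continuous_on_drop_time: "continuous_on UNIV drop_time"
  unfolding drop_time_def [abs_def]
  by (intro continuous_on_Pair continuous_on_coordinatewise_then_product continuous_on_snd continuous_on_id
      continuous_on_coordinate[OF continuous_on_fst[OF continuous_on_id]])

lemma continuous_on_drop_both: "continuous_on UNIV drop_both"
  unfolding drop_both_def [abs_def]
  by (intro continuous_on_Pair continuous_on_coordinatewise_then_product
      continuous_on_coordinate[OF continuous_on_fst[OF continuous_on_id]]
      continuous_on_coordinate[OF continuous_on_snd[OF continuous_on_id]])

lemma continuous_on_lap_first:
  "s > 0 \<Longrightarrow> continuous_on UNIV (\<lambda>p :: (nat \<Rightarrow> ennreal) \<times> 'c::topological_space. lap s (fst p n))"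
  by (rule continuous_on_compose2[OF continuous_on_lap continuous_on_coordinate[OF continuous_on_fst[OF continuous_on_id]]]) auto

text \<open>The first time is independent of everything else, and deleting the first entry of an iid
  sequence does not change its law. The function \<open>w\<close> is general so that
  \<open>lap s\<close> and the constant 1 are both covered.\<close>

lemma integral_limit_law_split:
  fixes Q :: "'f::polish_space measure" and w :: "ennreal \<Rightarrow> real" and h :: "(nat \<Rightarrow> ennreal) \<times> (nat \<Rightarrow> 'f) \<Rightarrow> real"
  assumes Q: "prob_space Q" "sets Q = sets borel" and w [measurable]: "w \<in> borel_measurable borel" and w1: "\<And>x. \<bar>w x\<bar> \<le> 1"
    and h [measurable]: "h \<in> borel_measurable borel" and B: "\<And>p. \<bar>h p\<bar> \<le> B"
  shows "(\<integral>p. w (fst p 0) * h (drop_time p) \<partial>limit_law Q) =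
           (\<integral>x. w x \<partial>exp_law) * (\<integral>p. h p \<partial>limit_law Q)" (is ?T1)
    and "(\<integral>p. w (fst p 0) * h (drop_both p) \<partial>limit_law Q) =
           (\<integral>x. w x \<partial>exp_law) * (\<integral>p. h p \<partial>limit_law Q)" (is ?T2)
proof -
  let ?E = exp_iid_law and ?P = "\<Pi>\<^sub>M n\<in>(UNIV::nat set). Q"
  interpret Q: prob_space Q by fact
  interpret P: prob_space ?P by (intro prob_space_PiM Q)
  interpret E: prob_space ?E by (rule prob_space_exp_iid_law)
  interpret EP: pair_prob_space ?E ?P ..
  have E_eq: "?E = (\<Pi>\<^sub>M n\<in>(UNIV::nat set). exp_law)" by (simp add: exp_iid_law_def)
  have sets_P: "sets ?P = sets borel"
    using Q(2) by (subst sets_PiM_equal_borel[symmetric], intro sets_PiM_cong) auto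
  have sets_EP: "sets (?E \<Otimes>\<^sub>M ?P) = sets (borel \<Otimes>\<^sub>M borel)"
    by (intro sets_pair_measure_cong sets_exp_iid_law sets_P)
  have h' [measurable]: "h \<in> borel_measurable (borel \<Otimes>\<^sub>M borel)"
    by (simp add: borel_prod)
  have meas_lap: "(\<lambda>p. w (fst p 0) * h (g p)) \<in> borel_measurable borel"
    if "continuous_on UNIV g" for g :: "(nat \<Rightarrow> ennreal) \<times> (nat \<Rightarrow> 'f) \<Rightarrow> (nat \<Rightarrow> ennreal) \<times> (nat \<Rightarrow> 'f)"
  proof (rule borel_measurable_times)
    show "(\<lambda>p :: (nat \<Rightarrow> ennreal) \<times> (nat \<Rightarrow> 'f). w (fst p 0)) \<in> borel_measurable borel"
      by (rule measurable_compose[OF borel_measurable_continuous_onI w])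
        (rule continuous_on_coordinate[OF continuous_on_fst[OF continuous_on_id]])
    show "(\<lambda>p. h (g p)) \<in> borel_measurable borel"
      by (rule measurable_compose[OF borel_measurable_continuous_onI[OF that] h])
  qed
  have lap_b: "\<bar>w x * h p\<bar> \<le> B" for x p
    using mult_mono[OF w1[of x] B[of p]] by (simp add: abs_mult)
  \<comment> \<open>The times are integrated first, so that \<open>split\<close> below can remove
    the first time with the observables held fixed.\<close>
  have fubini: "(\<integral>p. f p \<partial>limit_law Q) = (\<integral>\<psi>. \<integral>\<phi>. f (\<phi>, \<psi>) \<partial>?E \<partial>?P)"
    if "f \<in> borel_measurable borel" "\<And>p. \<bar>f p\<bar> \<le> B" for f :: "_ \<Rightarrow> real"
  proof -
    have "integrable (?E \<Otimes>\<^sub>M ?P) f"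
    proof (rule EP.integrable_const_bound[where B=B])
      show "f \<in> borel_measurable (?E \<Otimes>\<^sub>M ?P)"
        using that(1) unfolding measurable_cong_sets[OF sets_EP refl] borel_prod .
    qed (use that(2) in auto)
    then show ?thesis
      using EP.integral_snd[of "\<lambda>\<phi> \<psi>. f (\<phi>, \<psi>)"] by (simp add: limit_law_def)
  qed
  have split: "(\<integral>\<phi>. w (\<phi> 0) * h (\<lambda>n. \<phi> (Suc n), \<psi>) \<partial>?E) = (\<integral>x. w x \<partial>exp_law) * (\<integral>\<phi>. h (\<phi>, \<psi>) \<partial>?E)" for \<psi>
  proof -
    have "(\<integral>\<phi>. w (\<phi> 0) * h (\<lambda>n. \<phi> (Suc n), \<psi>) \<partial>?E) = (\<integral>x. w x \<partial>exp_law) * (\<integral>\<phi>. h (\<phi>, \<psi>) \<partial>?E)"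
      unfolding E_eq
    proof (rule sequence_space_integral_split[OF prob_space_exp_law, where C=1 and D=B])
      show "(\<lambda>\<phi>. h (\<phi>, \<psi>)) \<in> borel_measurable (Pi\<^sub>M UNIV (\<lambda>n. exp_law))"
        unfolding E_eq[symmetric] measurable_cong_sets[OF sets_exp_iid_law refl] by measurable
    qed (use w1 B in auto)
    then show ?thesis .
  qed
  have I: "(\<integral>\<psi>. \<integral>\<phi>. h (\<phi>, \<psi>) \<partial>?E \<partial>?P) = (\<integral>p. h p \<partial>limit_law Q)"
    by (rule fubini[symmetric, OF h B])
  have "(\<integral>p. w (fst p 0) * h (drop_time p) \<partial>limit_law Q) =
    (\<integral>\<psi>. \<integral>\<phi>. w (\<phi> 0) * h (\<lambda>n. \<phi> (Suc n), \<psi>) \<partial>?E \<partial>?P)"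
    by (subst fubini[OF meas_lap[OF continuous_on_drop_time] lap_b]) (simp add: drop_time_def)
  also have "\<dots> = (\<integral>x. w x \<partial>exp_law) * (\<integral>p. h p \<partial>limit_law Q)"
    unfolding split using I by simp
  finally show ?T1 .
  have meas_h: "(\<lambda>\<psi>. \<integral>\<phi>. h (\<phi>, \<psi>) \<partial>?E) \<in> borel_measurable ?P"
  proof (rule E.borel_measurable_lebesgue_integral)
    have "(\<lambda>(\<psi>, \<phi>). h (\<phi>, \<psi>)) \<in> borel_measurable (borel \<Otimes>\<^sub>M borel)" by measurable
    moreover have "sets (?P \<Otimes>\<^sub>M ?E) = sets (borel \<Otimes>\<^sub>M borel)"
      by (intro sets_pair_measure_cong sets_exp_iid_law sets_P)
    ultimately show "(\<lambda>(\<psi>, \<phi>). h (\<phi>, \<psi>)) \<in> borel_measurable (?P \<Otimes>\<^sub>M ?E)"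
      using measurable_cong_sets by blast
  qed
  have hb: "\<bar>\<integral>\<phi>. h (\<phi>, \<psi>) \<partial>?E\<bar> \<le> B" for \<psi>
  proof -
    have m: "(\<lambda>\<phi>. h (\<phi>, \<psi>)) \<in> borel_measurable ?E"
      unfolding measurable_cong_sets[OF sets_exp_iid_law refl] by measurable
    have "\<bar>\<integral>\<phi>. h (\<phi>, \<psi>) \<partial>?E\<bar> \<le> (\<integral>\<phi>. \<bar>h (\<phi>, \<psi>)\<bar> \<partial>?E)" by simp
    also have "\<dots> \<le> B"
      using m B by (intro E.integral_le_const E.integrable_const_bound[where B=B]) auto
    finally show ?thesis .
  qed
  have "(\<integral>p. w (fst p 0) * h (drop_both p) \<partial>limit_law Q) =
    (\<integral>\<psi>. \<integral>\<phi>. w (\<phi> 0) * h (\<lambda>n. \<phi> (Suc n), \<lambda>n. \<psi> (Suc n)) \<partial>?E \<partial>?P)"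
    by (subst fubini[OF meas_lap[OF continuous_on_drop_both] lap_b]) (simp add: drop_both_def)
  \<comment> \<open>The factor 1 is a trivial function of the first observable; in this form the
    splitting lemma for sequences removes that observable too.\<close>
  also have "\<dots> = (\<integral>\<psi>. 1 * (\<integral>\<phi>. h (\<phi>, \<lambda>n. \<psi> (Suc n)) \<partial>?E) \<partial>?P) * (\<integral>x. w x \<partial>exp_law)"
    unfolding split by simp
  also have "(\<integral>\<psi>. 1 * (\<integral>\<phi>. h (\<phi>, \<lambda>n. \<psi> (Suc n)) \<partial>?E) \<partial>?P) = (\<integral>\<psi>. 1 \<partial>Q) * (\<integral>\<psi>. \<integral>\<phi>. h (\<phi>, \<psi>) \<partial>?E \<partial>?P)"
    by (rule sequence_space_integral_split[OF Q(1) _ meas_h, where g="\<lambda>_. 1" and C=1 and D=B]) (use hb in auto)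
  also have "\<dots> = (\<integral>p. h p \<partial>limit_law Q)"
    using I Q.prob_space by simp
  finally show ?T2 by simp
qed

section \<open>Compactness and a dense algebra of test functions\<close>

text \<open>Tychonoff's theorem, carried over from abstract topologies to the topology of the
  function type.\<close>

lemma compact_UNIV_fun:
  assumes "compact (UNIV :: 'b::topological_space set)"
  shows "compact (UNIV :: (nat \<Rightarrow> 'b) set)"
proof -
  have "compact_space (euclidean :: 'b topology)"
    unfolding compact_space_def topspace_euclidean compactin_euclidean_iff by (rule assms)
  then have "compact_space (product_topology (\<lambda>i::nat. euclidean :: 'b topology) UNIV)"
    by (intro compact_space_product_topology[THEN iffD2] disjI2 ballI)
  then show ?thesis
    unfolding euclidean_product_topology compact_space_def topspace_euclidean compactin_euclidean_iff .
qed

text \<open>The library theorem asks for a Hausdorff type, but the instance for function types is available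
  only over metric spaces, which excludes sequences in ennreal; hence the detour through an embedding.\<close>

lemma Stone_Weierstrass_embedding:
  fixes \<Theta> :: "'b::topological_space \<Rightarrow> 'c::t2_space" and f :: "'b \<Rightarrow> real"
  assumes cpt: "compact (UNIV :: 'b set)" and \<Theta>: "continuous_on UNIV \<Theta>" "inj \<Theta>"
    and f: "continuous_on UNIV f" and e: "e > 0"
    and cont: "\<And>g. g \<in> R \<Longrightarrow> continuous_on UNIV g"
    and add: "\<And>g h. g \<in> R \<Longrightarrow> h \<in> R \<Longrightarrow> (\<lambda>x. g x + h x) \<in> R"
    and mult: "\<And>g h. g \<in> R \<Longrightarrow> h \<in> R \<Longrightarrow> (\<lambda>x. g x * h x) \<in> R"
    and const: "\<And>c. (\<lambda>_. c) \<in> R"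
    and sep: "\<And>x y. x \<noteq> y \<Longrightarrow> \<exists>g\<in>R. g x \<noteq> g y"
  shows "\<exists>g\<in>R. \<forall>x. \<bar>f x - g x\<bar> < e"
proof -
  let ?i = "inv \<Theta>"
  have inv: "?i (\<Theta> x) = x" for x
    using \<Theta>(2) by simp
  \<comment> \<open>A continuous injection of a compact space into a Hausdorff space has a
    continuous inverse on its range, so the whole problem can be moved to
    \<open>range \<Theta>\<close>.\<close>
  have cont_inv: "continuous_on (range \<Theta>) ?i"
    by (rule continuous_on_inv[OF \<Theta>(1) cpt]) (simp add: inv)
  have cont': "continuous_on (range \<Theta>) (\<lambda>y. g (?i y))" if "continuous_on UNIV g" for g :: "'b \<Rightarrow> real"
    by (rule continuous_on_compose2[OF that cont_inv]) simp
  let ?R = "(\<lambda>g y. g (?i y)) ` R"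
  have "function_ring_on ?R (range \<Theta>)"
  proof
    show "compact (range \<Theta>)" by (rule compact_continuous_image[OF \<Theta>(1) cpt])
    show "\<exists>g\<in>?R. g x \<noteq> g y" if xy: "x \<in> range \<Theta>" "y \<in> range \<Theta>" "x \<noteq> y" for x y
    proof -
      have "?i x \<noteq> ?i y"
        using xy f_inv_into_f[of x \<Theta> UNIV] f_inv_into_f[of y \<Theta> UNIV] by metis
      from sep[OF this] obtain g where "g \<in> R" "g (?i x) \<noteq> g (?i y)" by (elim bexE)
      then show ?thesis by (intro bexI[OF _ imageI]) simp_all
    qed
    show "continuous_on (range \<Theta>) g" if "g \<in> ?R" for g
    proof -
      obtain g' where "g = (\<lambda>y. g' (?i y))" "g' \<in> R" using \<open>g \<in> ?R\<close> by (elim imageE)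
      then show ?thesis using cont'[OF cont] by simp
    qed
    show "(\<lambda>y. g y + h y) \<in> ?R" if "g \<in> ?R" "h \<in> ?R" for g h
    proof -
      obtain g' h' where "g = (\<lambda>y. g' (?i y))" "h = (\<lambda>y. h' (?i y))" "g' \<in> R" "h' \<in> R"
        using \<open>g \<in> ?R\<close> \<open>h \<in> ?R\<close> by (elim imageE)
      then show ?thesis
        by (intro image_eqI[where x="\<lambda>x. g' x + h' x"]) (simp_all add: add)
    qed
    show "(\<lambda>y. g y * h y) \<in> ?R" if "g \<in> ?R" "h \<in> ?R" for g h
    proof -
      obtain g' h' where "g = (\<lambda>y. g' (?i y))" "h = (\<lambda>y. h' (?i y))" "g' \<in> R" "h' \<in> R"
        using \<open>g \<in> ?R\<close> \<open>h \<in> ?R\<close> by (elim imageE)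
      then show ?thesis
        by (intro image_eqI[where x="\<lambda>x. g' x * h' x"]) (simp_all add: mult)
    qed
    show "(\<lambda>_. c) \<in> ?R" for c
      by (rule image_eqI[OF _ const]) simp
  qed
  from function_ring_on.Stone_Weierstrass_basic[OF this cont'[OF f] e]
  obtain g where g: "g \<in> R" "\<forall>y\<in>range \<Theta>. \<bar>f (?i y) - g (?i y)\<bar> < e"
    by (elim bexE imageE) simp
  have "\<bar>f x - g x\<bar> < e" for x
    using bspec[OF g(2) rangeI[of \<Theta> x]] unfolding inv .
  then show ?thesis using g(1) by blast
qed

text \<open>The generators are the test functions whose integrals over the hitting pair can be
  controlled by the identity. Only sums are built in, since convergence of integrals passes to sums
  but not to products; closure under products is proved afterwards.\<close>

inductive_set lap_algebra :: "((nat \<Rightarrow> ennreal) \<times> (nat \<Rightarrow> 'f::metric_space) \<Rightarrow> real) set" where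
  base: "continuous_on UNIV h \<Longrightarrow> (\<lambda>p. lap 1 (fst p 0) ^ k * h (drop_time p)) \<in> lap_algebra"
| add: "f \<in> lap_algebra \<Longrightarrow> g \<in> lap_algebra \<Longrightarrow> (\<lambda>p. f p + g p) \<in> lap_algebra"

lemma continuous_on_lap_algebra: "f \<in> lap_algebra \<Longrightarrow> continuous_on UNIV f"
proof (induction rule: lap_algebra.induct)
  case (base h k)
  then show ?case
    by (intro continuous_on_mult continuous_on_power continuous_on_lap_first
        continuous_on_compose2[OF base continuous_on_drop_time]) auto
qed (intro continuous_on_add)

text \<open>The product of two generators is again a generator: exponents add and the functions of
  the remaining coordinates multiply. Sums follow by distributivity.\<close>

lemma lap_algebra_mult_base:
  assumes "f \<in> lap_algebra" "continuous_on UNIV h"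
  shows "(\<lambda>p. f p * (lap 1 (fst p 0) ^ k * h (drop_time p))) \<in> lap_algebra"
  using assms(1)
proof induction
  case (base h' k')
  then have "(\<lambda>p. lap 1 (fst p 0) ^ (k' + k) * (\<lambda>q. h' q * h q) (drop_time p)) \<in> lap_algebra"
    using assms(2) by (intro lap_algebra.base continuous_on_mult)
  then show ?case by (simp add: power_add mult_ac)
next
  case (add f g)
  then show ?case using lap_algebra.add[OF add.IH] by (simp add: distrib_right)
qed

lemma lap_algebra_mult:
  assumes "f \<in> lap_algebra" "g \<in> lap_algebra"
  shows "(\<lambda>p. f p * g p) \<in> lap_algebra"
  using assms(2)
proof induction
  case (base h k)
  then show ?case by (rule lap_algebra_mult_base[OF assms(1)])
next
  case (add g g')
  then show ?case using lap_algebra.add[OF add.IH] by (simp add: distrib_left)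
qed

lemma lap_algebra_dense:
  fixes f :: "(nat \<Rightarrow> ennreal) \<times> (nat \<Rightarrow> 'f::metric_space) \<Rightarrow> real"
  assumes cpt: "compact (UNIV :: 'f set)" and f: "continuous_on UNIV f" and e: "e > 0"
  shows "\<exists>g\<in>lap_algebra. \<forall>p. \<bar>f p - g p\<bar> < e"
proof -
  \<comment> \<open>Replacing every time by its real weight \<open>lap 1\<close> loses no
    information and lands in a Hausdorff space.\<close>
  define \<Theta> :: "(nat \<Rightarrow> ennreal) \<times> (nat \<Rightarrow> 'f) \<Rightarrow> (nat \<Rightarrow> real) \<times> (nat \<Rightarrow> 'f)"
    where "\<Theta> p = (\<lambda>n. lap 1 (fst p n), snd p)" for p
  have "continuous_on UNIV \<Theta>"
    unfolding \<Theta>_def [abs_def]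
    by (intro continuous_on_Pair continuous_on_coordinatewise_then_product continuous_on_lap_first
        continuous_on_snd continuous_on_id) simp
  moreover have "inj \<Theta>"
    by (rule injI) (auto simp: \<Theta>_def fun_eq_iff prod_eq_iff inj_eq[OF inj_lap[of 1]])
  ultimately show ?thesis
    using f e
  proof (rule Stone_Weierstrass_embedding[rotated])
    show "compact (UNIV :: ((nat \<Rightarrow> ennreal) \<times> (nat \<Rightarrow> 'f)) set)"
      using compact_Times[OF compact_UNIV_fun[OF compact_UNIV] compact_UNIV_fun[OF cpt]] by simp
    show "(\<lambda>_. c) \<in> lap_algebra" for c
      using lap_algebra.base[of "\<lambda>_. c" 0] by simp
    fix x y :: "(nat \<Rightarrow> ennreal) \<times> (nat \<Rightarrow> 'f)" assume "x \<noteq> y"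
    \<comment> \<open>The power \<open>k = 1\<close> separates first times. With
      \<open>k = 0\<close> any continuous function of the remaining coordinates is available: a
      weight separates later times, and the distance to an observable of \<open>x\<close> separates
      observables.\<close>
    then consider "fst x 0 \<noteq> fst y 0" | n where "fst x (Suc n) \<noteq> fst y (Suc n)" | n where "snd x n \<noteq> snd y n"
      by (metis ext not0_implies_Suc prod_eqI)
    then show "\<exists>f\<in>lap_algebra. f x \<noteq> f y"
    proof cases
      case 1
      have "(\<lambda>p. lap 1 (fst p 0) ^ 1 * (\<lambda>_. 1) (drop_time p)) \<in> lap_algebra"
        by (intro lap_algebra.base continuous_on_const)
      then show ?thesis
        using 1 injD[OF inj_lap[of 1]] by (intro bexI) auto
    next
      case 2
      have "(\<lambda>p. lap 1 (fst p 0) ^ 0 * (\<lambda>q. lap 1 (fst q n)) (drop_time p)) \<in> lap_algebra"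
        by (intro lap_algebra.base continuous_on_lap_first) simp
      then show ?thesis
        using 2 injD[OF inj_lap[of 1]] by (intro bexI) (auto simp: drop_time_def)
    next
      case 3
      have "(\<lambda>p. lap 1 (fst p 0) ^ 0 * (\<lambda>q. dist (snd q n) (snd x n)) (drop_time p)) \<in> lap_algebra"
        by (intro lap_algebra.base continuous_on_dist continuous_on_const
            continuous_on_coordinate[OF continuous_on_snd[OF continuous_on_id]])
      then show ?thesis
        using 3 by (intro bexI) (auto simp: drop_time_def)
    qed
  qed (auto intro: continuous_on_lap_algebra lap_algebra.add lap_algebra_mult)
qed

section \<open>Hitting pairs, return pairs and their duality\<close>

definition hitting_pair ::
  "('a \<Rightarrow> 'a) \<Rightarrow> 'a set \<Rightarrow> ('a \<Rightarrow> 'f) \<Rightarrow> real \<Rightarrow> 'a \<Rightarrow> (nat \<Rightarrow> ennreal) \<times> (nat \<Rightarrow> 'f)" where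
  "hitting_pair T A \<psi> c x = ((\<lambda>n. ennreal c * return_process T A x n), local_process T A \<psi> x)"

definition return_pair ::
  "('a \<Rightarrow> 'a) \<Rightarrow> 'a set \<Rightarrow> ('a \<Rightarrow> 'f) \<Rightarrow> real \<Rightarrow> 'a \<Rightarrow> (nat \<Rightarrow> ennreal) \<times> (nat \<Rightarrow> 'f)" where
  "return_pair T A \<psi> c x = ((\<lambda>n. ennreal c * return_process T A x n), local_process0 T A \<psi> x)"

lemma first_time_pair:
  "fst (hitting_pair T A \<psi> c x) 0 = ennreal c * ennreal_of_enat (hit_time T A x)"
  "fst (return_pair T A \<psi> c x) 0 = ennreal c * ennreal_of_enat (hit_time T A x)"
  by (simp_all add: hitting_pair_def return_pair_def return_process_def)

text \<open>Entry \<open>n\<close> of \<open>local_process\<close> is observed after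
  \<open>Suc n\<close> applications of the induced map, entry \<open>n\<close> of
  \<open>return_process\<close> after \<open>n\<close>. Removing the first time aligns both at
  \<open>induced_map T A x\<close>.\<close>

lemma drop_time_hitting_pair:
  "drop_time (hitting_pair T A \<psi> c x) = return_pair T A \<psi> c (induced_map T A x)"
  by (simp add: hitting_pair_def return_pair_def drop_time_def return_process_def [abs_def]
      local_process_def [abs_def] local_process0_def [abs_def] funpow_swap1)

lemma drop_both_return_pair:
  "drop_both (return_pair T A \<psi> c x) = return_pair T A \<psi> c (induced_map T A x)"
  by (simp add: return_pair_def drop_both_def return_process_def [abs_def]
      local_process0_def [abs_def] funpow_swap1)

lemma measurable_pairs:
  fixes \<psi> :: "'a \<Rightarrow> 'f::polish_space"
  assumes T [measurable]: "T \<in> measurable M M" and A [measurable]: "A \<in> sets M"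
    and \<psi>: "\<psi> \<in> borel_measurable (restrict_space M A)"
  shows "hitting_pair T A \<psi> c \<in> borel_measurable M" "return_pair T A \<psi> c \<in> borel_measurable M"
proof -
  have ind [measurable]: "(induced_map T A ^^ n) \<in> measurable M M" for n
    by (rule measurable_compose_n) measurable
  \<comment> \<open>\<open>loc_obs\<close> is constant off \<open>A\<close>, so measurability of
    \<open>\<psi>\<close> on \<open>A\<close> is enough.\<close>
  have obs: "loc_obs \<psi> A \<in> borel_measurable M"
    unfolding loc_obs_def [abs_def] using \<psi>
    by (intro measurable_If_restrict_space_iff[THEN iffD2]) auto
  have 1: "(\<lambda>x. ennreal c * return_process T A x n) \<in> borel_measurable M" for n
    unfolding return_process_def by measurable
  have 2: "(\<lambda>x. loc_obs \<psi> A ((induced_map T A ^^ n) x)) \<in> borel_measurable M" for n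
    by (rule measurable_compose[OF ind obs])
  show "hitting_pair T A \<psi> c \<in> borel_measurable M" "return_pair T A \<psi> c \<in> borel_measurable M"
    unfolding hitting_pair_def [abs_def] return_pair_def [abs_def] local_process_def [abs_def] local_process0_def [abs_def]
    by (intro borel_measurable_Pair measurable_coordinatewise_then_product 1 2)+
qed

text \<open>The Palm-type identity for the observable \<open>h\<close> of the return pair. Since
  \<open>c\<close> is the measure of \<open>A\<close>, dividing by \<open>c\<close> turns integrals
  over \<open>A\<close> into expectations under the conditional measure.\<close>

lemma hitting_return_duality:
  fixes \<psi> :: "'a \<Rightarrow> 'f::polish_space" and h :: "(nat \<Rightarrow> ennreal) \<times> (nat \<Rightarrow> 'f) \<Rightarrow> real"
  assumes M: "prob_space M" and T [measurable]: "T \<in> measurable M M" and inv: "distr M M T = M"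
    and A [measurable]: "A \<in> sets M" and \<psi>: "\<psi> \<in> borel_measurable (restrict_space M A)"
    and s: "s > 0" and c: "c = measure M A" "c > 0"
    and h [measurable]: "h \<in> borel_measurable borel" and B: "\<And>p. \<bar>h p\<bar> \<le> B"
  defines "H \<equiv> hitting_pair T A \<psi> c" and "R \<equiv> return_pair T A \<psi> c"
  shows "(exp (s * c) - 1) / c * (\<integral>x. lap s (fst (H x) 0) * h (drop_time (H x)) \<partial>M) =
         (\<integral>x. h (R x) \<partial>uniform_measure M A) -
         (\<integral>x. lap s (fst (R x) 0) * h (drop_both (R x)) \<partial>uniform_measure M A)"
proof -
  have hR [measurable]: "(\<lambda>x. h (R x)) \<in> borel_measurable M"
    unfolding R_def by (rule measurable_compose[OF measurable_pairs(2)[OF T A \<psi>] h])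
  let ?G = "\<lambda>x. lap s (ennreal c * ennreal_of_enat (hit_time T A x)) * h (R (induced_map T A x))"
  have G [measurable]: "?G \<in> borel_measurable M"
    using s by measurable
  have "(exp (s * c) - 1) * (\<integral>x. ?G x \<partial>M) =
      (\<integral>x. indicator A x * h (R x) \<partial>M) - (\<integral>x. indicator A x * ?G x \<partial>M)"
    by (rule integral_lap_hit_time[OF M T inv A s c(2) hR]) (rule B)
  moreover have "drop_both (R x) = R (induced_map T A x)" "drop_time (H x) = R (induced_map T A x)"
    "fst (R x) 0 = ennreal c * ennreal_of_enat (hit_time T A x)"
    "fst (H x) 0 = ennreal c * ennreal_of_enat (hit_time T A x)" for x
    by (simp_all add: H_def R_def first_time_pair drop_time_hitting_pair drop_both_return_pair)
  ultimately show ?thesis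
    using integral_uniform_measure[OF M A hR] integral_uniform_measure[OF M A G] c
    by (simp add: field_simps)
qed

lemma compact_imp_bounded_range:
  fixes f :: "'b::topological_space \<Rightarrow> real"
  assumes "compact (UNIV :: 'b set)" "continuous_on UNIV f"
  obtains B where "\<And>x. \<bar>f x\<bar> \<le> B"
  using compact_imp_bounded[OF compact_continuous_image[OF assms(2,1)]]
  by (auto simp: bounded_iff)

text \<open>The expression is the difference quotient at 0 of the function
  \<open>exp (s * x)\<close>, whose derivative there is \<open>s\<close>.\<close>

lemma tendsto_exp_diff_quotient:
  fixes c :: "nat \<Rightarrow> real" and s :: real
  assumes "c \<longlonglongrightarrow> 0" "\<And>l. c l > 0"
  shows "(\<lambda>l. (exp (s * c l) - 1) / c l) \<longlonglongrightarrow> s"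
proof -
  have "((\<lambda>x. exp (s * x)) has_real_derivative s) (at 0)"
    by (auto intro!: derivative_eq_intros)
  then have "((\<lambda>h. (exp (s * h) - 1) / h) \<longlongrightarrow> s) (at 0)"
    by (simp add: DERIV_def)
  moreover have "filterlim c (at 0) sequentially"
    using assms by (simp add: filterlim_at less_imp_neq[THEN not_sym])
  ultimately show ?thesis by (rule filterlim_compose)
qed

section \<open>Duality along a rare sequence\<close>

locale rare_events = prob_space M for M :: "'a measure" +
  fixes T :: "'a \<Rightarrow> 'a" and A :: "nat \<Rightarrow> 'a set" and \<psi> :: "nat \<Rightarrow> 'a \<Rightarrow> 'f::polish_space"
    and Q :: "'f measure"
  assumes T_meas: "T \<in> measurable M M" and T_inv: "distr M M T = M"
    and cpt: "compact (UNIV :: 'f set)"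
    and A_sets: "\<And>l. A l \<in> sets M"
    and A_pos: "\<And>l. 0 < measure M (A l)"
    and A_rare: "(\<lambda>l. measure M (A l)) \<longlonglongrightarrow> 0"
    and \<psi>_meas: "\<And>l. \<psi> l \<in> borel_measurable (restrict_space M (A l))"
    and Q_prob: "prob_space Q" and Q_sets: "sets Q = sets borel"
begin

abbreviation "H l \<equiv> hitting_pair T (A l) (\<psi> l) (measure M (A l))"
abbreviation "R l \<equiv> return_pair T (A l) (\<psi> l) (measure M (A l))"
abbreviation "\<nu> l \<equiv> uniform_measure M (A l)"
abbreviation I :: "((nat \<Rightarrow> ennreal) \<times> (nat \<Rightarrow> 'f) \<Rightarrow> real) \<Rightarrow> real" where
  "I f \<equiv> \<integral>p. f p \<partial>limit_law Q"

lemma prob_space_\<nu>: "prob_space (\<nu> l)"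
  using A_pos[of l] by (intro prob_space_uniform_measure) (auto simp: emeasure_eq_measure)

text \<open>Compactness bounds every continuous function, which supplies the boundedness asked for
  by \<open>weak_conv_law\<close> and by the integrability proofs.\<close>

lemma compact_state: "compact (UNIV :: ((nat \<Rightarrow> ennreal) \<times> (nat \<Rightarrow> 'f)) set)"
  using compact_Times[OF compact_UNIV_fun[OF compact_UNIV] compact_UNIV_fun[OF cpt]] by simp

lemma borel_state:
  "continuous_on UNIV f \<Longrightarrow> f \<in> borel_measurable (borel :: ((nat \<Rightarrow> ennreal) \<times> (nat \<Rightarrow> 'f)) measure)"
  by (rule borel_measurable_continuous_onI)

lemma integrable_state:
  fixes f :: "(nat \<Rightarrow> ennreal) \<times> (nat \<Rightarrow> 'f) \<Rightarrow> real"
  assumes f: "continuous_on UNIV f"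
  shows "integrable M (\<lambda>x. f (H l x))" "integrable (\<nu> l) (\<lambda>x. f (R l x))" "integrable (limit_law Q) f"
proof -
  obtain B where B: "\<And>p. \<bar>f p\<bar> \<le> B" using compact_imp_bounded_range[OF compact_state f] by blast
  interpret L: prob_space "limit_law Q" by (rule prob_space_limit_law[OF Q_prob])
  interpret N: prob_space "\<nu> l" by (rule prob_space_\<nu>)
  have "(\<lambda>x. f (H l x)) \<in> borel_measurable M" "(\<lambda>x. f (R l x)) \<in> borel_measurable M"
    by (rule measurable_compose[OF _ borel_state[OF f]], rule measurable_pairs[OF T_meas A_sets \<psi>_meas])+
  then show "integrable M (\<lambda>x. f (H l x))" "integrable (\<nu> l) (\<lambda>x. f (R l x))"
    by (auto intro!: integrable_const_bound[where B=B] N.integrable_const_bound[where B=B] B)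
  have "f \<in> borel_measurable (limit_law Q)"
    using borel_state[OF f] sets_limit_law[OF Q_sets] measurable_cong_sets by blast
  then show "integrable (limit_law Q) f"
    by (intro L.integrable_const_bound[where B=B]) (auto intro: B)
qed

lemma duality:
  assumes s: "s > 0" and h: "continuous_on UNIV h"
  shows "(exp (s * measure M (A l)) - 1) / measure M (A l) *
           (\<integral>x. lap s (fst (H l x) 0) * h (drop_time (H l x)) \<partial>M) =
         (\<integral>x. h (R l x) \<partial>\<nu> l) - (\<integral>x. lap s (fst (R l x) 0) * h (drop_both (R l x)) \<partial>\<nu> l)"
proof -
  obtain B where "\<And>p. \<bar>h p\<bar> \<le> B" using compact_imp_bounded_range[OF compact_state h] by blast
  then show ?thesis
    by (rule hitting_return_duality[OF prob_space_axioms T_meas T_inv A_sets \<psi>_meas s refl A_pos borel_state[OF h]])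
qed

lemma continuous_on_lap_drop:
  assumes "s > 0" "continuous_on UNIV (h :: (nat \<Rightarrow> ennreal) \<times> (nat \<Rightarrow> 'f) \<Rightarrow> real)"
  shows "continuous_on UNIV (\<lambda>p. lap s (fst p 0) * h (drop_time p))"
    and "continuous_on UNIV (\<lambda>p. lap s (fst p 0) * h (drop_both p))"
  by (rule continuous_on_mult[OF continuous_on_lap_first[OF assms(1)]
        continuous_on_compose2[OF assms(2) continuous_on_drop_time subset_UNIV]],
      rule continuous_on_mult[OF continuous_on_lap_first[OF assms(1)]
        continuous_on_compose2[OF assms(2) continuous_on_drop_both subset_UNIV]])

lemma I_lap:
  assumes s: "s > 0" and h: "continuous_on UNIV h"
  shows "I (\<lambda>p. lap s (fst p 0) * h (drop_time p)) = I h / (1 + s)"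
    and "I (\<lambda>p. lap s (fst p 0) * h (drop_both p)) = I h / (1 + s)"
proof -
  obtain B where B: "\<And>p. \<bar>h p\<bar> \<le> B" using compact_imp_bounded_range[OF compact_state h] by blast
  note * = integral_limit_law_split[OF Q_prob Q_sets measurable_lap[OF s] abs_lap_le_1 borel_state[OF h] B]
  show "I (\<lambda>p. lap s (fst p 0) * h (drop_time p)) = I h / (1 + s)" using *(1) s by (simp add: integral_lap_exp_law)
  show "I (\<lambda>p. lap s (fst p 0) * h (drop_both p)) = I h / (1 + s)" using *(2) s by (simp add: integral_lap_exp_law)
qed

section \<open>From hitting limits to return limits\<close>

text \<open>For \<open>h\<close> \<ge> 0 the subtracted integral in \<open>duality\<close> is
  nonnegative, so the return integral dominates the hitting side, which tends to
  \<open>s * (I h / (1 + s))\<close>. This is close to \<open>I h\<close> for large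
  \<open>s\<close>.\<close>

lemma return_liminf:
  assumes conv: "weak_conv_law (\<lambda>_. M) H (limit_law Q)"
    and h: "continuous_on UNIV h" "\<And>p. 0 \<le> h p" and e: "e > 0"
  shows "eventually (\<lambda>l. I h - e < (\<integral>x. h (R l x) \<partial>\<nu> l)) sequentially"
proof -
  have Ih: "0 \<le> I h" using h(2) by simp
  \<comment> \<open>With this choice \<open>e * (1 + s) = I h + 2 * e\<close>, so the loss
    \<open>I h / (1 + s)\<close> stays below \<open>e\<close>.\<close>
  define s where "s = I h / e + 1"
  have s: "s > 0" using Ih e by (simp add: s_def add_nonneg_pos)
  have "I h < e * (1 + s)" using e by (simp add: s_def field_simps)
  then have "I h / (1 + s) < e"
    using s by (simp add: pos_divide_less_eq)
  moreover have "s * (I h / (1 + s)) = I h - I h / (1 + s)"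
    using s by (simp add: field_simps)
  ultimately have lt: "I h - e < s * (I h / (1 + s))" by simp
  let ?f = "\<lambda>p. lap s (fst p 0) * h (drop_time p)"
  let ?a = "\<lambda>l. (exp (s * measure M (A l)) - 1) / measure M (A l)"
  have f: "continuous_on UNIV ?f" by (rule continuous_on_lap_drop(1)[OF s h(1)])
  have "bounded (range ?f)"
    by (rule compact_imp_bounded[OF compact_continuous_image[OF f compact_state]])
  then have "(\<lambda>l. \<integral>x. ?f (H l x) \<partial>M) \<longlonglongrightarrow> I ?f"
    using conv f unfolding weak_conv_law_def by blast
  then have "(\<lambda>l. ?a l * (\<integral>x. ?f (H l x) \<partial>M)) \<longlonglongrightarrow> s * (I h / (1 + s))"
    unfolding I_lap(1)[OF s h(1)]
    by (intro tendsto_mult tendsto_exp_diff_quotient A_rare A_pos)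
  then have "eventually (\<lambda>l. I h - e < ?a l * (\<integral>x. ?f (H l x) \<partial>M)) sequentially"
    by (rule order_tendstoD(1)[OF _ lt])
  then show ?thesis
  proof (rule eventually_mono)
    fix l assume "I h - e < ?a l * (\<integral>x. ?f (H l x) \<partial>M)"
    moreover have "0 \<le> (\<integral>x. lap s (fst (R l x) 0) * h (drop_both (R l x)) \<partial>\<nu> l)"
      using h(2) by simp
    ultimately show "I h - e < (\<integral>x. h (R l x) \<partial>\<nu> l)"
      unfolding duality[OF s h(1)] by linarith
  qed
qed

text \<open>The one-sided bound suffices: applied to \<open>B + h\<close> it bounds the return
  integral of \<open>h\<close> from below, applied to \<open>B - h\<close> from above.\<close>

lemma hitting_imp_return:
  assumes conv: "weak_conv_law (\<lambda>_. M) H (limit_law Q)"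
  shows "weak_conv_law \<nu> R (limit_law Q)"
  unfolding weak_conv_law_def
proof (intro allI impI, elim conjE)
  fix h :: "(nat \<Rightarrow> ennreal) \<times> (nat \<Rightarrow> 'f) \<Rightarrow> real" assume h: "continuous_on UNIV h"
  obtain B where B: "\<And>p. \<bar>h p\<bar> \<le> B" using compact_imp_bounded_range[OF compact_state h] by blast
  interpret L: prob_space "limit_law Q" by (rule prob_space_limit_law[OF Q_prob])
  note int = integrable_state[OF h]
  have plus: "(\<integral>x. B + h (R l x) \<partial>\<nu> l) = B + (\<integral>x. h (R l x) \<partial>\<nu> l)"
    "(\<integral>x. B - h (R l x) \<partial>\<nu> l) = B - (\<integral>x. h (R l x) \<partial>\<nu> l)" for l
  proof -
    interpret N: prob_space "\<nu> l" by (rule prob_space_\<nu>)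
    show "(\<integral>x. B + h (R l x) \<partial>\<nu> l) = B + (\<integral>x. h (R l x) \<partial>\<nu> l)"
      "(\<integral>x. B - h (R l x) \<partial>\<nu> l) = B - (\<integral>x. h (R l x) \<partial>\<nu> l)"
      using int(2)[of l] N.prob_space by simp_all
  qed
  have plus': "I (\<lambda>p. B + h p) = B + I h" "I (\<lambda>p. B - h p) = B - I h"
    using int(3) L.prob_space by simp_all
  have nn: "0 \<le> B + h p" "0 \<le> B - h p" for p using B[of p] by linarith+
  show "(\<lambda>l. \<integral>x. h (R l x) \<partial>\<nu> l) \<longlonglongrightarrow> I h"
  proof (rule tendstoI)
    fix e :: real assume e: "e > 0"
    have "eventually (\<lambda>l. I (\<lambda>p. B + h p) - e < (\<integral>x. B + h (R l x) \<partial>\<nu> l)) sequentially"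
      by (intro return_liminf[OF conv _ _ e] continuous_on_add continuous_on_const h nn)
    moreover have "eventually (\<lambda>l. I (\<lambda>p. B - h p) - e < (\<integral>x. B - h (R l x) \<partial>\<nu> l)) sequentially"
      by (intro return_liminf[OF conv _ _ e] continuous_on_diff continuous_on_const h nn)
    ultimately show "eventually (\<lambda>l. dist (\<integral>x. h (R l x) \<partial>\<nu> l) (I h) < e) sequentially"
      unfolding plus plus' by eventually_elim (auto simp: dist_real_def)
  qed
qed

section \<open>From return limits to hitting limits\<close>

text \<open>\<open>duality\<close> is solved for the hitting integral. Its right side tends to
  \<open>I h - I h / (1 + s)\<close>, that is \<open>s * (I h / (1 + s))\<close>, and the prefactor
  tends to \<open>s\<close>, which is not 0.\<close>

lemma hitting_lap_limit:
  assumes conv: "weak_conv_law \<nu> R (limit_law Q)"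
    and s: "s > 0" and h: "continuous_on UNIV h"
  shows "(\<lambda>l. \<integral>x. lap s (fst (H l x) 0) * h (drop_time (H l x)) \<partial>M) \<longlonglongrightarrow> I h / (1 + s)"
proof -
  let ?a = "\<lambda>l. (exp (s * measure M (A l)) - 1) / measure M (A l)"
  let ?x = "\<lambda>l. \<integral>x. lap s (fst (H l x) 0) * h (drop_time (H l x)) \<partial>M"
  have conv': "(\<lambda>l. \<integral>x. f (R l x) \<partial>\<nu> l) \<longlonglongrightarrow> I f" if f: "continuous_on UNIV f" for f
    using conv f compact_imp_bounded[OF compact_continuous_image[OF f compact_state]]
    unfolding weak_conv_law_def by blast
  have "(\<lambda>l. ?a l * ?x l) \<longlonglongrightarrow> I h - I h / (1 + s)"
    unfolding duality[OF s h]
    using tendsto_diff[OF conv'[OF h] conv'[OF continuous_on_lap_drop(2)[OF s h]]]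
    by (simp add: I_lap(2)[OF s h])
  then have "(\<lambda>l. (?a l * ?x l) / ?a l) \<longlonglongrightarrow> (I h - I h / (1 + s)) / s"
    using s by (intro tendsto_divide tendsto_exp_diff_quotient A_rare A_pos) auto
  moreover have "?a l \<noteq> 0" for l
    using s A_pos[of l] by simp
  moreover have "I h - I h / (1 + s) = s * (I h / (1 + s))"
    using s by (simp add: field_simps)
  ultimately show ?thesis using s by simp
qed

text \<open>The unweighted case, reached by letting \<open>s\<close> be small. The limit of the
  total weight is \<open>1 / (1 + s)\<close>, close to 1, so little mass of the rescaled first
  hitting time can escape to infinity.\<close>

lemma hitting_rest_limit:
  assumes conv: "weak_conv_law \<nu> R (limit_law Q)" and h: "continuous_on UNIV h"
  shows "(\<lambda>l. \<integral>x. h (drop_time (H l x)) \<partial>M) \<longlonglongrightarrow> I h"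
proof (rule tendstoI)
  fix e :: real assume e: "e > 0"
  obtain B' where B': "\<And>p. \<bar>h p\<bar> \<le> B'" using compact_imp_bounded_range[OF compact_state h] by blast
  \<comment> \<open>The added 1 keeps \<open>B\<close> positive, as the next choice divides by
    it.\<close>
  define B where "B = \<bar>B'\<bar> + 1"
  have B: "\<bar>h p\<bar> \<le> B" "B > 0" for p using B'[of p] by (auto simp: B_def)
  interpret L: prob_space "limit_law Q" by (rule prob_space_limit_law[OF Q_prob])
  \<comment> \<open>Then \<open>B * s = e / 4\<close>. This controls both the error from inserting
    the weight and the gap between \<open>I h / (1 + s)\<close> and \<open>I h\<close>.\<close>
  define s where "s = e / (4 * B)"
  have s: "s > 0" using e B by (simp add: s_def)
  have hd: "continuous_on UNIV (\<lambda>p. h (drop_time p))"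
    by (rule continuous_on_compose2[OF h continuous_on_drop_time]) simp
  let ?f = "\<lambda>p. lap s (fst p 0) * h (drop_time p)"
  let ?u = "\<lambda>l. \<integral>x. lap s (fst (H l x) 0) \<partial>M"
  note f = continuous_on_lap_drop(1)[OF s h]
  have u: "?u \<longlonglongrightarrow> 1 / (1 + s)"
    using hitting_lap_limit[OF conv s, of "\<lambda>_. 1"] L.prob_space by simp
  \<comment> \<open>Inserting the weight costs at most \<open>B\<close> times the missing weight
    \<open>1 - ?u l\<close>.\<close>
  have close: "\<bar>(\<integral>x. h (drop_time (H l x)) \<partial>M) - (\<integral>x. ?f (H l x) \<partial>M)\<bar> \<le> B * (1 - ?u l)" for l
  proof -
    have iu: "integrable M (\<lambda>x. lap s (fst (H l x) 0))"
      by (rule integrable_state(1)[OF continuous_on_lap_first[OF s]])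
    have eq: "(\<integral>x. h (drop_time (H l x)) \<partial>M) - (\<integral>x. ?f (H l x) \<partial>M) =
        (\<integral>x. h (drop_time (H l x)) - ?f (H l x) \<partial>M)"
      using integrable_state(1)[OF hd] integrable_state(1)[OF f] by simp
    have "\<bar>(\<integral>x. h (drop_time (H l x)) \<partial>M) - (\<integral>x. ?f (H l x) \<partial>M)\<bar> \<le>
        (\<integral>x. \<bar>h (drop_time (H l x)) - ?f (H l x)\<bar> \<partial>M)"
      unfolding eq by (rule integral_abs_bound)
    also have "\<dots> \<le> (\<integral>x. B * (1 - lap s (fst (H l x) 0)) \<partial>M)"
    proof (rule integral_mono)
      show "integrable M (\<lambda>x. \<bar>h (drop_time (H l x)) - ?f (H l x)\<bar>)"
        using integrable_state(1)[OF hd] integrable_state(1)[OF f] by (intro integrable_abs Bochner_Integration.integrable_diff)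
      show "integrable M (\<lambda>x. B * (1 - lap s (fst (H l x) 0)))"
        using iu by simp
      fix x
      have "\<bar>h (drop_time (H l x)) - ?f (H l x)\<bar> = \<bar>h (drop_time (H l x))\<bar> * \<bar>1 - lap s (fst (H l x) 0)\<bar>"
        by (simp add: algebra_simps flip: abs_mult)
      also have "\<dots> \<le> B * (1 - lap s (fst (H l x) 0))"
        using B lap_le_1[of s "fst (H l x) 0"] s by (intro mult_mono) auto
      finally show "\<bar>h (drop_time (H l x)) - ?f (H l x)\<bar> \<le> B * (1 - lap s (fst (H l x) 0))" .
    qed
    also have "\<dots> = B * (1 - ?u l)" using iu prob_space by simp
    finally show ?thesis .
  qed
  have Ib: "\<bar>I h\<bar> \<le> B"
  proof -
    have "\<bar>I h\<bar> \<le> (\<integral>p. \<bar>h p\<bar> \<partial>limit_law Q)" by simp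
    also have "\<dots> \<le> B"
      using integrable_state(3)[OF h] B by (intro L.integral_le_const) auto
    finally show ?thesis .
  qed
  have s1: "1 - 1 / (1 + s) = s / (1 + s)" "s / (1 + s) \<le> s"
    using s by (simp_all add: field_simps)
  have "B * (1 - 1 / (1 + s)) \<le> B * s"
    unfolding s1(1) using s1(2) B(2) by (intro mult_left_mono) auto
  also have "B * s < e / 2" using B e by (simp add: s_def)
  finally have lim1: "B * (1 - 1 / (1 + s)) < e / 2" .
  have "I h / (1 + s) - I h = - (I h * (s / (1 + s)))"
    using s by (simp add: field_simps)
  then have "\<bar>I h / (1 + s) - I h\<bar> = \<bar>I h\<bar> * (s / (1 + s))"
    using s by (simp add: abs_mult)
  also have "\<dots> \<le> B * s" using Ib s1(2) s B by (intro mult_mono) auto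
  also have "B * s < e / 2" using B e by (simp add: s_def)
  finally have lim2: "\<bar>I h / (1 + s) - I h\<bar> < e / 2" .
  have "eventually (\<lambda>l. B * (1 - ?u l) < e / 2) sequentially"
    by (rule order_tendstoD(2)[OF _ lim1]) (intro tendsto_intros u)
  moreover have "eventually (\<lambda>l. \<bar>(\<integral>x. ?f (H l x) \<partial>M) - I h\<bar> < e / 2) sequentially"
    by (rule order_tendstoD(2)[OF _ lim2]) (intro tendsto_intros hitting_lap_limit conv s h)
  ultimately show "eventually (\<lambda>l. dist (\<integral>x. h (drop_time (H l x)) \<partial>M) (I h) < e) sequentially"
  proof eventually_elim
    case (elim l)
    then show ?case using close[of l] unfolding dist_real_def by linarith
  qed
qed

lemma I_drop_time:
  assumes h: "continuous_on UNIV h"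
  shows "I (\<lambda>p. h (drop_time p)) = I h"
proof -
  obtain B where B: "\<And>p. \<bar>h p\<bar> \<le> B" using compact_imp_bounded_range[OF compact_state h] by blast
  have "prob_space.prob exp_law (space exp_law) = 1"
    by (rule prob_space.prob_space[OF prob_space_exp_law])
  then show ?thesis
    using integral_limit_law_split(1)[OF Q_prob Q_sets _ _ borel_state[OF h] B, of "\<lambda>_. 1"] by simp
qed

text \<open>Convergence holds for the generators of \<open>lap_algebra\<close>, hence for their
  sums, and extends to all continuous functions by uniform approximation.\<close>

lemma return_imp_hitting:
  assumes conv: "weak_conv_law \<nu> R (limit_law Q)"
  shows "weak_conv_law (\<lambda>_. M) H (limit_law Q)"
  unfolding weak_conv_law_def
proof (intro allI impI, elim conjE)
  fix f :: "(nat \<Rightarrow> ennreal) \<times> (nat \<Rightarrow> 'f) \<Rightarrow> real" assume f: "continuous_on UNIV f"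
  interpret L: prob_space "limit_law Q" by (rule prob_space_limit_law[OF Q_prob])
  have alg: "(\<lambda>l. \<integral>x. g (H l x) \<partial>M) \<longlonglongrightarrow> I g" if "g \<in> lap_algebra" for g
    using that
  proof induction
    case (base h k)
    show ?case
    \<comment> \<open>For \<open>k > 0\<close> the power is the weight \<open>lap (real k)\<close>;
      for \<open>k = 0\<close> it is the constant 1, which is not \<open>lap 0\<close>, so the
      unweighted limit is used.\<close>
    proof (cases "k = 0")
      case True
      then show ?thesis using hitting_rest_limit[OF conv base] I_drop_time[OF base] by simp
    next
      case False
      then show ?thesis
        using hitting_lap_limit[OF conv _ base, of "real k"] I_lap(1)[OF _ base, of "real k"]
        by (simp add: lap_power)
    qed
  next
    case (add g g')
    note c = continuous_on_lap_algebra[OF add.hyps(1)] continuous_on_lap_algebra[OF add.hyps(2)]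
    show ?case
      using tendsto_add[OF add.IH] by (simp add: integrable_state[OF c(1)] integrable_state[OF c(2)])
  qed
  show "(\<lambda>l. \<integral>x. f (H l x) \<partial>M) \<longlonglongrightarrow> I f"
  proof (rule tendstoI)
    fix e :: real assume e: "e > 0"
    then obtain g where g: "g \<in> lap_algebra" and fg: "\<And>p. \<bar>f p - g p\<bar> < e / 3"
      using lap_algebra_dense[OF cpt f, of "e / 3"] by auto
    note gc = continuous_on_lap_algebra[OF g]
    have 1: "\<bar>(\<integral>x. f (H l x) \<partial>M) - (\<integral>x. g (H l x) \<partial>M)\<bar> \<le> e / 3" for l
    proof -
      have eq: "(\<integral>x. f (H l x) \<partial>M) - (\<integral>x. g (H l x) \<partial>M) = (\<integral>x. f (H l x) - g (H l x) \<partial>M)"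
        using integrable_state(1)[OF f] integrable_state(1)[OF gc] by simp
      have "\<bar>(\<integral>x. f (H l x) \<partial>M) - (\<integral>x. g (H l x) \<partial>M)\<bar> \<le> (\<integral>x. \<bar>f (H l x) - g (H l x)\<bar> \<partial>M)"
        unfolding eq by (rule integral_abs_bound)
      also have "\<dots> \<le> e / 3"
        using integrable_state(1)[OF f] integrable_state(1)[OF gc] less_imp_le[OF fg]
        by (intro integral_le_const) auto
      finally show ?thesis .
    qed
    have 2: "\<bar>I f - I g\<bar> \<le> e / 3"
    proof -
      have eq: "I f - I g = I (\<lambda>p. f p - g p)"
        using integrable_state(3)[OF f] integrable_state(3)[OF gc] by simp
      have "\<bar>I f - I g\<bar> \<le> I (\<lambda>p. \<bar>f p - g p\<bar>)"
        unfolding eq by (rule integral_abs_bound)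
      also have "\<dots> \<le> e / 3"
        using integrable_state(3)[OF f] integrable_state(3)[OF gc] less_imp_le[OF fg]
        by (intro L.integral_le_const) auto
      finally show ?thesis .
    qed
    have "e / 3 > 0" using e by simp
    then have "eventually (\<lambda>l. dist (\<integral>x. g (H l x) \<partial>M) (I g) < e / 3) sequentially"
      by (rule tendstoD[OF alg[OF g]])
    then show "eventually (\<lambda>l. dist (\<integral>x. f (H l x) \<partial>M) (I f) < e) sequentially"
    proof eventually_elim
      case (elim l)
      then show ?case using 1[of l] 2 unfolding dist_real_def by linarith
    qed
  qed
qed

end

theorem mainTheorem8:
  fixes M :: "'a measure" and T :: "'a \<Rightarrow> 'a"
    and A :: "nat \<Rightarrow> 'a set"
    and \<psi> :: "nat \<Rightarrow> 'a \<Rightarrow> 'f::polish_space"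
    and \<tau> :: "nat \<Rightarrow> 'a \<Rightarrow> nat"
    and K :: "'a measure set"
    and Q :: "'f measure"
  assumes erg: "ergodic_pps M T"
    and F_compact: "compact (UNIV :: 'f set)"
    and A_sets: "\<And>l. A l \<in> sets M"
    and A_pos: "\<And>l. 0 < measure M (A l)"
    and A_rare: "(\<lambda>l. measure M (A l)) \<longlonglongrightarrow> 0"
    and \<psi>_meas: "\<And>l. \<psi> l \<in> borel_measurable (restrict_space M (A l))"
    and \<tau>_meas: "\<And>l. \<tau> l \<in> measurable M (count_space UNIV)"
    and \<tau>_before: "(\<lambda>l. measure (uniform_measure M (A l))
                        {x \<in> space M. enat (\<tau> l x) < hit_time T (A l) x}) \<longlonglongrightarrow> 1"
    and K_sub: "K \<subseteq> abs_cont_probs M"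
    and K_compact: "compactin (Metric_space.mtopology (abs_cont_probs M) (dP M)) K"
    and push_in_K: "\<And>l. distr (uniform_measure M (A l)) M (\<lambda>x. (T ^^ \<tau> l x) x) \<in> K"
    and Q_prob: "prob_space Q"
    and Q_sets: "sets Q = sets borel"
  shows "weak_conv_law (\<lambda>l. M)
           (\<lambda>l x. ((\<lambda>n. ennreal (measure M (A l)) * return_process T (A l) x n),
                   local_process T (A l) (\<psi> l) x)) (limit_law Q)
         \<longleftrightarrow>
         weak_conv_law (\<lambda>l. uniform_measure M (A l))
           (\<lambda>l x. ((\<lambda>n. ennreal (measure M (A l)) * return_process T (A l) x n),
                   local_process0 T (A l) (\<psi> l) x)) (limit_law Q)"
proof -
  have pps: "prob_space M" "T \<in> measurable M M" "distr M M T = M"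
    using erg unfolding ergodic_pps_def by auto
  interpret rare_events M T A \<psi> Q
    by (intro rare_events.intro rare_events_axioms.intro)
      (fact pps F_compact A_sets A_pos A_rare \<psi>_meas Q_prob Q_sets)+
  show ?thesis
    using iffI[OF hitting_imp_return return_imp_hitting]
    unfolding hitting_pair_def [abs_def] return_pair_def [abs_def] .
qed

end
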